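(* Let $A$ and $E$ be real symmetric $n\times n$ matrices with $E\neq0$, and $\tilde A=A+E$. For $K>0$ let $r$ denote the number of singular values of $A$ (with multiplicity) that are at most $\sigma_n+K\|E\|$. Assume that for some parameter $K>0$, $$\sigma_n\ >\ 90\log\!\left(3+\frac{\sigma_1}{\sqrt{r\,x\,\|E\|}}\right)\max\left\{\frac{\|E\|}{K},\ \sqrt{r\,x\,\|E\|}\right\}.$$ Then $$\tilde\sigma_n\ \ge\ \sigma_n-45\log\!\left(3+\frac{\sigma_1}{\sqrt{r\,x\,\|E\|}}\right)\max\left\{\frac{\|E\|}{K},\ \sqrt{r\,x\,\|E\|}\right\}.$$
   Context: $\|\cdot\|$ is the spectral norm; $\log$ is natural. $\sigma_1\ge\dots\ge\sigma_n$ are the singular values of $A$ and $\tilde\sigma_1\ge\dots\ge\tilde\sigma_n$ those of $\tilde A$. Fix an orthonormal eigenbasis $u_1,\dots,u_n$ of $A$ (any choice is allowed when eigenvalues are multiple) and put $x:=\max_{1\le i,j\le n}|u_i^\top E u_j|$. *)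

theory Defs
  imports
    "HOL-Analysis.Analysis"
    "HOL-Computational_Algebra.Polynomial"
begin

definition charpoly :: "real^'n^'n \<Rightarrow> real poly" where
  "charpoly A = det ((\<chi> i j. (if i = j then [:0, 1:] else 0) - [:A $ i $ j:]) :: real poly^'n^'n)"

text \<open>
  The matrix \<open>A\<^sup>T A\<close> is symmetric and positive semidefinite, so its characteristic polynomial
  has \<open>CARD('n)\<close> real nonnegative roots with multiplicity (\<open>proots\<close>), and the multiset
  below has exactly \<open>CARD('n)\<close> elements.
\<close>

definition singular_values :: "real^'n^'n \<Rightarrow> real multiset" where
  "singular_values A = image_mset sqrt (proots (charpoly (transpose A ** A)))"

text \<open>
  The singular values in decreasing order, numbered from 1: the meaningful range is
  \<open>1 \<le> k \<le> CARD('n)\<close>.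
\<close>

definition singular_value :: "real^'n^'n \<Rightarrow> nat \<Rightarrow> real" where
  "singular_value A k = rev (sorted_list_of_multiset (singular_values A)) ! (k - 1)"

definition spectral_norm :: "real^'n^'n \<Rightarrow> real" where
  "spectral_norm A = onorm (\<lambda>v. A *v v)"

text \<open>The index type has \<open>CARD('n)\<close> elements, so such a family is automatically a basis.\<close>

definition orthonormal_eigenbasis :: "real^'n^'n \<Rightarrow> ('n \<Rightarrow> real^'n) \<Rightarrow> bool" where
  "orthonormal_eigenbasis A u \<longleftrightarrow>
     (\<forall>i j. u i \<bullet> u j = (if i = j then 1 else 0)) \<and>
     (\<forall>i. \<exists>c. A *v u i = c *\<^sub>R u i)"

end

theory Submission
  imports Defs
begin

text \<open>
  The smallest singular value of \<open>A + E\<close> is \<open>\<bar>\<mu>\<bar>\<close> for some eigenvalue \<open>\<mu>\<close>, with unit eigenvector \<open>v\<close>, so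
  \<open>(\<mu> - c\<^sub>i) (u\<^sub>i \<bullet> v) = u\<^sub>i \<bullet> E v\<close> for every eigenpair \<open>(c\<^sub>i, u\<^sub>i)\<close> of \<open>A\<close>. Let \<open>S\<close> be the set of the \<open>r\<close> indices
  with \<open>\<bar>c\<^sub>i\<bar> \<le> \<sigma>\<^sub>n + K \<parallel>E\<parallel>\<close>, and suppose \<open>\<bar>\<mu>\<bar> < \<sigma>\<^sub>n - \<delta>\<close>. Outside \<open>S\<close> one has \<open>\<bar>\<mu> - c\<^sub>i\<bar> \<ge> K \<parallel>E\<parallel> + \<delta>\<close>, so the
  component \<open>q\<close> of \<open>v\<close> there is small. On \<open>S\<close> one has \<open>\<bar>\<mu> - c\<^sub>i\<bar> \<ge> \<delta>\<close>, while the compression of \<open>E\<close> to the span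
  of the \<open>u\<^sub>i\<close> has norm at most \<open>min (r x) \<parallel>E\<parallel> \<le> sqrt (r x \<parallel>E\<parallel>)\<close>, so the component \<open>p\<close> is small as well,
  contradicting \<open>\<parallel>p\<parallel>\<^sup>2 + \<parallel>q\<parallel>\<^sup>2 = 1\<close>. The logarithm enters only through its being at least 1.
\<close>

section \<open>Spectral theorem for real symmetric matrices\<close>

lemma symmetric_matrix_inner:
  fixes B :: "real^'n^'n"
  assumes "transpose B = B"
  shows "v \<bullet> (B *v w) = (B *v v) \<bullet> w"
  by (metis assms dot_lmul_matrix transpose_matrix_vector)

text \<open>By compactness the quadratic form \<open>v \<bullet> (B *v v)\<close> attains its
  maximum on the unit sphere of \<open>S\<close>, and a maximiser is an eigenvector. Invariance of
  \<open>S\<close> is needed to keep the residual \<open>m *\<^sub>R v - B *v v\<close> in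
  \<open>S\<close>, where it serves as direction of variation.\<close>

lemma symmetric_eigenvector_in_subspace:
  fixes B :: "real^'n^'n"
  assumes sym: "transpose B = B" and S: "subspace S" and inv: "\<And>v. v \<in> S \<Longrightarrow> B *v v \<in> S"
    and ne: "w \<in> S" "w \<noteq> 0"
  obtains v c where "v \<in> S" "norm v = 1" "B *v v = c *\<^sub>R v"
proof -
  let ?T = "S \<inter> sphere 0 1"
  have "compact ?T"
    by (simp add: S closed_Int_compact closed_subspace)
  moreover have "(1 / norm w) *\<^sub>R w \<in> ?T"
    using ne S by (simp add: subspace_mul)
  moreover have "continuous_on ?T (\<lambda>v. v \<bullet> (B *v v))"
    by (intro continuous_intros linear_continuous_on matrix_vector_mul_bounded_linear)
  ultimately have "\<exists>v\<in>?T. \<forall>y\<in>?T. y \<bullet> (B *v y) \<le> v \<bullet> (B *v v)"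
    by (intro continuous_attains_sup) auto
  then obtain v where v: "v \<in> ?T" and max: "\<And>y. y \<in> ?T \<Longrightarrow> y \<bullet> (B *v y) \<le> v \<bullet> (B *v v)"
    by blast
  define m where "m = v \<bullet> (B *v v)"
  define g where "g y = m * (y \<bullet> y) - y \<bullet> (B *v y)" for y
  have g_nonneg: "g y \<ge> 0" if "y \<in> S" for y
  proof (cases "y = 0")
    case False
    let ?y = "(1 / norm y) *\<^sub>R y"
    have "?y \<in> ?T" using that False S by (simp add: subspace_mul)
    then have "?y \<bullet> (B *v ?y) \<le> m" unfolding m_def by (rule max)
    then have "(y \<bullet> (B *v y)) / (norm y)\<^sup>2 \<le> m"
      by (simp add: matrix_vector_mult_scaleR power2_eq_square)
    then show ?thesis
      using False by (simp add: g_def field_simps power2_norm_eq_inner)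
  qed (simp add: g_def)
  \<comment> \<open>\<open>g\<close> is nonnegative on \<open>S\<close> and vanishes at the maximiser \<open>v\<close>, which forces its gradient \<open>2 z\<close> at \<open>v\<close> to vanish.\<close>
  define z where "z = m *\<^sub>R v - B *v v"
  have vv: "v \<bullet> v = 1" using v by (simp add: norm_eq_1)
  have zS: "z \<in> S" using v S inv by (simp add: z_def subspace_diff subspace_mul)
  have expand: "g (v + t *\<^sub>R z) = 2 * t * (z \<bullet> z) + t\<^sup>2 * g z" for t
  proof -
    have "z \<bullet> (B *v v) = v \<bullet> (B *v z)"
      using symmetric_matrix_inner[OF sym, of v z] by (simp add: inner_commute)
    then have "g (v + t *\<^sub>R z) = 2 * t * (m * (v \<bullet> z) - z \<bullet> (B *v v)) + t\<^sup>2 * g z"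
      using vv m_def
      by (simp add: g_def matrix_vector_right_distrib matrix_vector_mult_scaleR inner_add_left
          inner_add_right inner_commute[of z v] power2_eq_square algebra_simps)
    moreover have "z \<bullet> z = m * (v \<bullet> z) - z \<bullet> (B *v v)"
      by (subst (2) z_def) (simp add: inner_diff_right inner_commute)
    ultimately show ?thesis by simp
  qed
  have "z = 0"
  proof (rule ccontr)
    assume "z \<noteq> 0"
    then have pos: "z \<bullet> z > 0" by simp
    let ?c = "g z"
    have c: "?c \<ge> 0" using g_nonneg zS by blast
    \<comment> \<open>The quadratic in \<open>t\<close> has its minimum at
      \<open>- (z \<bullet> z) / ?c\<close>; the denominator \<open>1 + ?c\<close> still makes it
      negative and also covers \<open>?c = 0\<close>.\<close>
    let ?t = "- (z \<bullet> z) / (1 + ?c)"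
    have "v + ?t *\<^sub>R z \<in> S" using v zS S by (intro subspace_add subspace_mul) auto
    then have "0 \<le> 2 * ?t * (z \<bullet> z) + ?t\<^sup>2 * ?c" using g_nonneg expand by metis
    also have "\<dots> = - ((z \<bullet> z)\<^sup>2 * (2 + ?c)) / (1 + ?c)\<^sup>2"
      using c by (simp add: field_simps power2_eq_square add_nonneg_eq_0_iff)
    also have "\<dots> < 0"
      using pos c by (intro divide_neg_pos) auto
    finally show False by simp
  qed
  then show ?thesis using that[of v m] v by (simp add: z_def)
qed

text \<open>Induction on the set of indices already served: by symmetry the orthogonal complement of
  eigenvectors is invariant under \<open>B\<close>, so it contains a further unit eigenvector as
  long as it is nonzero.\<close>

lemma symmetric_orthonormal_eigenbasis_exists:
  fixes B :: "real^'n^'n"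
  assumes sym: "transpose B = B"
  shows "\<exists>u. orthonormal_eigenbasis B u"
proof -
  have "\<exists>u. (\<forall>i\<in>I. \<forall>j\<in>I. u i \<bullet> u j = (if i = j then 1 else 0)) \<and> (\<forall>i\<in>I. \<exists>c. B *v u i = c *\<^sub>R u i)"
    if "finite I" for I :: "'n set"
    using that
  proof (induction I rule: finite_induct)
    case (insert k I)
    then obtain u where on: "\<And>i j. i \<in> I \<Longrightarrow> j \<in> I \<Longrightarrow> u i \<bullet> u j = (if i = j then 1 else 0)"
      and eig: "\<And>i. i \<in> I \<Longrightarrow> \<exists>c. B *v u i = c *\<^sub>R u i" by blast
    define S where "S = {w. \<forall>i\<in>I. u i \<bullet> w = 0}"
    have S: "subspace S"
      by (auto simp: S_def subspace_def inner_add_right)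
    have inv: "B *v v \<in> S" if "v \<in> S" for v
    proof -
      have "u i \<bullet> (B *v v) = 0" if "i \<in> I" for i
        using eig[OF that] \<open>v \<in> S\<close> that by (auto simp: S_def symmetric_matrix_inner[OF sym])
      then show ?thesis by (simp add: S_def)
    qed
    \<comment> \<open>The index \<open>k\<close> is still free, so the vectors chosen so far span a
      proper subspace and some nonzero \<open>w\<close> is orthogonal to all of them.\<close>
    have "I \<noteq> UNIV" using insert.hyps(2) by auto
    then have "card I < CARD('n)"
      by (simp add: psubset_card_mono psubset_eq)
    then have "dim (u ` I) < DIM(real^'n)"
      using dim_le_card'[of "u ` I"] card_image_le[of I u] insert.hyps(1) by simp
    then obtain w where "w \<noteq> 0" "\<And>y. y \<in> span (u ` I) \<Longrightarrow> orthogonal w y"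
      using orthogonal_to_subspace_exists by metis
    then have "w \<in> S" unfolding S_def by (simp add: orthogonal_def span_base inner_commute[of _ w])
    then obtain v c where v: "v \<in> S" "norm v = 1" "B *v v = c *\<^sub>R v"
      using symmetric_eigenvector_in_subspace[OF sym S inv] \<open>w \<noteq> 0\<close> by metis
    have "u i \<bullet> v = 0" "v \<bullet> u i = 0" if "i \<in> I" for i
      using v(1) that by (auto simp: S_def inner_commute)
    then show ?case
      using v on eig insert.hyps(2)
      by (intro exI[of _ "u(k := v)"]) (auto simp: norm_eq_1)
  qed simp
  from this[of UNIV] show ?thesis by (simp add: orthonormal_eigenbasis_def)
qed

section \<open>Coordinates in an orthonormal eigenbasis\<close>

lemma orthonormal_eigenbasisE:
  assumes "orthonormal_eigenbasis A u"
  obtains c where "\<And>i j. u i \<bullet> u j = (if i = j then 1 else 0)" "\<And>i. A *v u i = c i *\<^sub>R u i"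
proof -
  have "\<forall>i. \<exists>c. A *v u i = c *\<^sub>R u i"
    using assms by (simp add: orthonormal_eigenbasis_def)
  then obtain c where "\<forall>i. A *v u i = c i *\<^sub>R u i" by (rule choice[THEN exE])
  then show thesis using that assms unfolding orthonormal_eigenbasis_def by blast
qed

lemma orthonormal_rows_inverse:
  fixes u :: "'n \<Rightarrow> real^'n"
  assumes "\<And>i j. u i \<bullet> u j = (if i = j then 1 else 0)"
  shows "(\<chi> i. u i) ** transpose (\<chi> i. u i) = mat 1" "transpose (\<chi> i. u i) ** (\<chi> i. u i) = mat 1"
proof -
  show "(\<chi> i. u i) ** transpose (\<chi> i. u i) = mat 1"
    using assms by (simp add: vec_eq_iff matrix_matrix_mult_def transpose_def mat_def inner_vec_def)
  then show "transpose (\<chi> i. u i) ** (\<chi> i. u i) = mat 1"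
    by (simp add: matrix_left_right_inverse)
qed

lemma parseval:
  fixes u :: "'n \<Rightarrow> real^'n"
  assumes "\<And>i j. u i \<bullet> u j = (if i = j then 1 else 0)"
  shows "(norm w)\<^sup>2 = (\<Sum>i\<in>UNIV. (u i \<bullet> w)\<^sup>2)" and "w = (\<Sum>i\<in>UNIV. (u i \<bullet> w) *\<^sub>R u i)"
proof -
  let ?P = "(\<chi> i. u i) :: real^'n^'n"
  have P: "?P *v w = (\<chi> i. u i \<bullet> w)"
    by (simp add: vec_eq_iff matrix_vector_mult_def inner_vec_def)
  have "w = transpose ?P *v (?P *v w)"
    by (simp add: matrix_vector_mul_assoc orthonormal_rows_inverse[OF assms])
  also have "\<dots> = (\<Sum>i\<in>UNIV. (u i \<bullet> w) *\<^sub>R u i)"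
    unfolding P by (simp add: vec_eq_iff matrix_vector_mult_def transpose_def mult.commute)
  finally show w: "w = (\<Sum>i\<in>UNIV. (u i \<bullet> w) *\<^sub>R u i)" .
  have "(norm w)\<^sup>2 = w \<bullet> (\<Sum>i\<in>UNIV. (u i \<bullet> w) *\<^sub>R u i)"
    using w by (simp add: power2_norm_eq_inner)
  then show "(norm w)\<^sup>2 = (\<Sum>i\<in>UNIV. (u i \<bullet> w)\<^sup>2)"
    by (simp add: inner_sum_right inner_commute power2_eq_square)
qed

section \<open>Characteristic polynomial and singular values of a symmetric matrix\<close>

lemma poly_charpoly: "poly (charpoly M) t = det (mat t - M)"
proof -
  have "poly (if i = j then [:0, 1:] else 0) t = (if i = j then t else 0)" for i j :: 'a
    by simp
  then show ?thesis
    by (simp add: charpoly_def det_def poly_sum poly_prod mat_def)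
qed

text \<open>Conjugation by the orthogonal matrix with rows \<open>u i\<close> makes
  \<open>mat t - M\<close> diagonal without changing its determinant. Agreement of the values at
  every real \<open>t\<close> then gives equality of the polynomials.\<close>

lemma charpoly_orthonormal_eigenbasis:
  fixes M :: "real^'n^'n" and u :: "'n \<Rightarrow> real^'n"
  assumes on: "\<And>i j. u i \<bullet> u j = (if i = j then 1 else 0)" and eig: "\<And>i. M *v u i = c i *\<^sub>R u i"
  shows "charpoly M = (\<Prod>i\<in>UNIV. [:- c i, 1:])"
proof -
  let ?P = "(\<chi> i. u i) :: real^'n^'n"
  have "det (mat t - M) = (\<Prod>i\<in>UNIV. t - c i)" for t
  proof -
    let ?D = "(\<chi> i j. if i = j then t - c i else 0) :: real^'n^'n"
    have *: "(mat t - M) *v u j = (t - c j) *\<^sub>R u j" for j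
    proof -
      have "mat t *v u j = t *\<^sub>R u j"
        by (simp add: vec_eq_iff matrix_vector_mult_def mat_def if_distrib[of "\<lambda>a. a * _"] cong: if_cong)
      then show ?thesis
        by (simp add: matrix_vector_mult_diff_rdistrib eig scaleR_diff_left)
    qed
    have "(?P ** ((mat t - M) ** transpose ?P)) $ i $ j = ?D $ i $ j" for i j
    proof -
      have "((mat t - M) ** transpose ?P) $ k $ j = ((mat t - M) *v u j) $ k" for k
        by (simp add: matrix_matrix_mult_def matrix_vector_mult_def transpose_def)
      then have "(?P ** ((mat t - M) ** transpose ?P)) $ i $ j = u i \<bullet> ((mat t - M) *v u j)"
        by (simp add: matrix_matrix_mult_def[of ?P] inner_vec_def)
      then show ?thesis using on by (simp add: *)
    qed
    then have "?P ** ((mat t - M) ** transpose ?P) = ?D"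
      by (simp add: vec_eq_iff)
    then have "det ?P * (det (mat t - M) * det (transpose ?P)) = det ?D"
      by (metis det_mul)
    moreover have "det ?P * det (transpose ?P) = 1"
      by (metis det_I det_mul on orthonormal_rows_inverse(1))
    moreover have "det ?D = (\<Prod>i\<in>UNIV. t - c i)"
      by (subst det_diagonal) auto
    ultimately show ?thesis by (metis mult.left_commute mult.right_neutral)
  qed
  then have "poly (charpoly M) = poly (\<Prod>i\<in>UNIV. [:- c i, 1:])"
    by (auto simp: fun_eq_iff poly_charpoly poly_prod)
  then show ?thesis by (simp add: poly_eq_poly_eq_iff)
qed

text \<open>The \<open>u i\<close> are also eigenvectors of \<open>transpose B ** B\<close>, with
  eigenvalues \<open>(c i)\<^sup>2\<close>, whose roots are \<open>\<bar>c i\<bar>\<close>. Thus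
  singular values can be counted, with multiplicity, by the indices of any given eigenbasis.\<close>

lemma singular_values_symmetric:
  fixes B :: "real^'n^'n" and u :: "'n \<Rightarrow> real^'n"
  assumes sym: "transpose B = B" and on: "\<And>i j. u i \<bullet> u j = (if i = j then 1 else 0)"
    and eig: "\<And>i. B *v u i = c i *\<^sub>R u i"
  shows "singular_values B = image_mset (\<lambda>i. \<bar>c i\<bar>) (mset_set UNIV)"
proof -
  have "(transpose B ** B) *v u i = (c i)\<^sup>2 *\<^sub>R u i" for i
    by (simp add: sym eig matrix_vector_mult_scaleR power2_eq_square flip: matrix_vector_mul_assoc)
  then have "charpoly (transpose B ** B) = (\<Prod>i\<in>UNIV. [:- (c i)\<^sup>2, 1:])"
    by (rule charpoly_orthonormal_eigenbasis[OF on])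
  then have "proots (charpoly (transpose B ** B)) = (\<Sum>i\<in>UNIV. {#(c i)\<^sup>2#})"
    by (simp add: proots_prod)
  also have "\<dots> = image_mset (\<lambda>i. (c i)\<^sup>2) (mset_set UNIV)"
    by (simp add: sum_unfold_sum_mset)
  finally show ?thesis
    by (simp add: singular_values_def multiset.map_comp comp_def)
qed

lemma singular_value_last:
  fixes B :: "real^'n^'n"
  assumes "size (singular_values B) = CARD('n)"
  shows "singular_value B CARD('n) \<in># singular_values B"
    and "\<And>s. s \<in># singular_values B \<Longrightarrow> singular_value B CARD('n) \<le> s"
    and "singular_value B 1 \<in># singular_values B"
proof -
  let ?xs = "sorted_list_of_multiset (singular_values B)"
  have len: "length ?xs = CARD('n)"
    by (metis assms mset_sorted_list_of_multiset size_mset)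
  \<comment> \<open>Position \<open>CARD('n) - 1\<close> of the reversed list is position 0 of the
    increasing list, hence its least entry.\<close>
  have last: "singular_value B CARD('n) = ?xs ! 0"
    using len by (simp add: singular_value_def rev_nth)
  have set: "set ?xs = set_mset (singular_values B)" by simp
  show "singular_value B CARD('n) \<in># singular_values B"
    using last set len nth_mem[of 0 ?xs] by auto
  show "singular_value B CARD('n) \<le> s" if "s \<in># singular_values B" for s
    using that set unfolding last by (metis in_set_conv_nth le0 sorted_nth_mono sorted_sorted_list_of_multiset)
  have "singular_value B 1 \<in> set (rev ?xs)"
    unfolding singular_value_def using len by (intro nth_mem) simp
  then show "singular_value B 1 \<in># singular_values B" using set by simp
qed

lemma eigenvalue_singular_value_last:
  fixes B :: "real^'n^'n"
  assumes sym: "transpose B = B"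
  obtains v \<mu> where "norm v = 1" "B *v v = \<mu> *\<^sub>R v" "\<bar>\<mu>\<bar> = singular_value B CARD('n)"
proof -
  obtain u where "orthonormal_eigenbasis B u"
    using symmetric_orthonormal_eigenbasis_exists[OF sym] ..
  then obtain c where on: "\<And>i j. u i \<bullet> u j = (if i = j then 1 else 0)"
    and eig: "\<And>i. B *v u i = c i *\<^sub>R u i"
    using orthonormal_eigenbasisE by blast
  note sv = singular_values_symmetric[OF sym on eig]
  have "singular_value B CARD('n) \<in># singular_values B"
    by (rule singular_value_last) (simp add: sv)
  then obtain i where "singular_value B CARD('n) = \<bar>c i\<bar>" by (auto simp: sv)
  then show ?thesis using that[of "u i" "c i"] on eig by (simp add: norm_eq_1)
qed

section \<open>Perturbation estimates for eigenvectors\<close>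

text \<open>The compression of \<open>E\<close> to the span of the \<open>u i\<close> with
  \<open>i \<in> S\<close> has norm at most \<open>e\<close>, and at most \<open>card S * x\<close>
  by its entries. The square of the smaller bound is at most their product, which is the source of
  the term \<open>sqrt (r * x * e)\<close> in the theorem.\<close>

lemma compression_bound:
  fixes E :: "real^'n^'n" and u :: "'n \<Rightarrow> real^'n" and a :: "'n \<Rightarrow> real"
  assumes on: "\<And>i j. u i \<bullet> u j = (if i = j then 1 else 0)"
    and e: "\<And>w. norm (E *v w) \<le> e * norm w" "e \<ge> 0"
    and x: "\<And>i j. \<bar>u i \<bullet> (E *v u j)\<bar> \<le> x"
    and w: "w = (\<Sum>j\<in>S. a j *\<^sub>R u j)"
  shows "(\<Sum>i\<in>S. (u i \<bullet> (E *v w))\<^sup>2) \<le> real (card S) * x * e * (norm w)\<^sup>2"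
proof -
  let ?Y = "\<Sum>i\<in>S. (u i \<bullet> (E *v w))\<^sup>2" and ?r = "real (card S)"
  have x0: "x \<ge> 0" using x by (meson abs_ge_zero order_trans)
  have nw: "(norm w)\<^sup>2 = (\<Sum>j\<in>S. (a j)\<^sup>2)"
  proof -
    have "(u i \<bullet> w)\<^sup>2 = (if i \<in> S then (a i)\<^sup>2 else 0)" for i
      by (simp add: w inner_sum_right on if_distrib cong: if_cong)
    then show ?thesis
      by (simp add: parseval(1)[OF on] sum.If_cases)
  qed
  have Y1: "?Y \<le> e\<^sup>2 * (norm w)\<^sup>2"
  proof -
    have "?Y \<le> (norm (E *v w))\<^sup>2"
      unfolding parseval(1)[OF on, of "E *v w"] by (intro sum_mono2) auto
    also have "\<dots> \<le> (e * norm w)\<^sup>2" using e by (intro power_mono) auto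
    finally show ?thesis by (simp add: power_mult_distrib)
  qed
  have Y2: "?Y \<le> (?r * x)\<^sup>2 * (norm w)\<^sup>2"
  proof -
    \<comment> \<open>Cauchy-Schwarz in each row gives one factor \<open>card S\<close>; summing
      over the rows gives the second.\<close>
    have "(u i \<bullet> (E *v w))\<^sup>2 \<le> ?r * x\<^sup>2 * (norm w)\<^sup>2" for i
    proof -
      have "E *v w = (\<Sum>j\<in>S. a j *\<^sub>R (E *v u j))"
        by (simp add: w matrix_vector_mult_scaleR linear_sum[OF matrix_vector_mul_linear])
      then have "(u i \<bullet> (E *v w))\<^sup>2 = (\<Sum>j\<in>S. a j * (u i \<bullet> (E *v u j)))\<^sup>2"
        by (simp add: inner_sum_right)
      also have "\<dots> \<le> (\<Sum>j\<in>S. (a j)\<^sup>2) * (\<Sum>j\<in>S. (u i \<bullet> (E *v u j))\<^sup>2)"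
        by (rule Cauchy_Schwarz_ineq_sum)
      also have "\<dots> \<le> (\<Sum>j\<in>S. (a j)\<^sup>2) * (\<Sum>j\<in>S. x\<^sup>2)"
      proof (intro mult_left_mono sum_mono)
        show "(u i \<bullet> (E *v u j))\<^sup>2 \<le> x\<^sup>2" for j
          using power_mono[OF x[of i j] abs_ge_zero, where n = 2] by simp
      qed (simp add: sum_nonneg)
      finally show ?thesis by (simp add: nw mult.commute)
    qed
    then have "?Y \<le> (\<Sum>i\<in>S. ?r * x\<^sup>2 * (norm w)\<^sup>2)" by (intro sum_mono)
    then show ?thesis by (simp add: power_mult_distrib power2_eq_square mult_ac)
  qed
  show ?thesis
  proof (cases "?r * x \<le> e")
    case True
    then have "(?r * x)\<^sup>2 \<le> ?r * x * e"
      using x0 by (simp add: power2_eq_square mult_left_mono)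
    then show ?thesis using Y2 mult_right_mono[of "(?r * x)\<^sup>2" "?r * x * e" "(norm w)\<^sup>2"] by simp
  next
    case False
    then have "e\<^sup>2 \<le> ?r * x * e"
      using e(2) by (simp add: power2_eq_square mult_right_mono)
    then show ?thesis using Y1 mult_right_mono[of "e\<^sup>2" "?r * x * e" "(norm w)\<^sup>2"] by simp
  qed
qed

text \<open>\<open>\<delta>\<close> stands for \<open>45 * L * M\<close> in the final application.
  The coordinates of \<open>v\<close> outside \<open>S\<close> are estimated first, since through
  \<open>E *v q\<close> they enter the estimate on \<open>S\<close> as an error term.\<close>

lemma no_eigenvalue_in_gap:
  fixes A E :: "real^'n^'n" and u :: "'n \<Rightarrow> real^'n" and c :: "'n \<Rightarrow> real"
  assumes sym: "transpose A = A"
    and on: "\<And>i j. u i \<bullet> u j = (if i = j then 1 else 0)" and eig: "\<And>i. A *v u i = c i *\<^sub>R u i"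
    and e: "\<And>w. norm (E *v w) \<le> e * norm w" "e > 0"
    and x: "\<And>i j. \<bar>u i \<bullet> (E *v u j)\<bar> \<le> x"
    and K: "K > 0" and \<delta>: "\<delta> \<ge> 45 * (e / K)" "\<delta> \<ge> 45 * sqrt (real (card S) * x * e)"
    and gap: "\<And>i. \<delta> \<le> \<bar>\<mu> - c i\<bar>" and gap': "\<And>i. i \<notin> S \<Longrightarrow> K * e + \<delta> \<le> \<bar>\<mu> - c i\<bar>"
    and v: "norm v = 1"
  shows "(A + E) *v v \<noteq> \<mu> *\<^sub>R v"
proof
  assume *: "(A + E) *v v = \<mu> *\<^sub>R v"
  define a where "a i = u i \<bullet> v" for i
  define p q where "p = (\<Sum>i\<in>S. a i *\<^sub>R u i)" and "q = (\<Sum>i\<in>-S. a i *\<^sub>R u i)"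
  have coord: "(\<mu> - c i) * a i = u i \<bullet> (E *v v)" for i
  proof -
    have "u i \<bullet> (A *v v) = c i * a i"
      by (simp add: symmetric_matrix_inner[OF sym] eig a_def)
    moreover have "u i \<bullet> (A *v v) + u i \<bullet> (E *v v) = \<mu> * a i"
      using arg_cong[OF *, of "\<lambda>y. u i \<bullet> y"]
      by (simp add: matrix_vector_mult_add_rdistrib inner_add_right a_def)
    ultimately show ?thesis by (simp add: algebra_simps)
  qed
  have \<delta>0: "\<delta> > 0" using \<delta>(1) e(2) K by (smt (verit) divide_pos_pos)
  have vpq: "v = p + q"
    using parseval(2)[OF on, of v] sum.subset_diff[of S UNIV "\<lambda>i. a i *\<^sub>R u i"]
    by (simp add: p_def q_def a_def Compl_eq_Diff_UNIV add.commute)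
  have np: "(norm p)\<^sup>2 = (\<Sum>i\<in>S. (a i)\<^sup>2)" and nq: "(norm q)\<^sup>2 = (\<Sum>i\<in>-S. (a i)\<^sup>2)"
  proof -
    have "(u i \<bullet> p)\<^sup>2 = (if i \<in> S then (a i)\<^sup>2 else 0)"
      and "(u i \<bullet> q)\<^sup>2 = (if i \<in> -S then (a i)\<^sup>2 else 0)" for i
      by (simp_all add: p_def q_def inner_sum_right on if_distrib cong: if_cong)
    then show "(norm p)\<^sup>2 = (\<Sum>i\<in>S. (a i)\<^sup>2)" "(norm q)\<^sup>2 = (\<Sum>i\<in>-S. (a i)\<^sup>2)"
      by (simp_all only: parseval(1)[OF on, of p] parseval(1)[OF on, of q])
         (simp_all add: sum.If_cases del: Compl_iff)
  qed
  have pq: "(norm p)\<^sup>2 + (norm q)\<^sup>2 = 1"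
    using parseval(1)[OF on, of v] v sum.subset_diff[of S UNIV "\<lambda>i. (a i)\<^sup>2"]
    by (simp add: np nq a_def Compl_eq_Diff_UNIV add.commute)
  have Ebound: "(\<Sum>i\<in>T. (u i \<bullet> (E *v w))\<^sup>2) \<le> e\<^sup>2 * (norm w)\<^sup>2" for T w
  proof -
    have "(\<Sum>i\<in>T. (u i \<bullet> (E *v w))\<^sup>2) \<le> (norm (E *v w))\<^sup>2"
      unfolding parseval(1)[OF on, of "E *v w"] by (intro sum_mono2) auto
    also have "\<dots> \<le> (e * norm w)\<^sup>2" using e by (intro power_mono) auto
    finally show ?thesis by (simp add: power_mult_distrib)
  qed
  have q1: "(K * e + \<delta>)\<^sup>2 * (norm q)\<^sup>2 \<le> e\<^sup>2"
  proof -
    have "(K * e + \<delta>)\<^sup>2 * (a i)\<^sup>2 \<le> (u i \<bullet> (E *v v))\<^sup>2" if "i \<in> -S" for i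
    proof -
      have "(K * e + \<delta>)\<^sup>2 \<le> (\<mu> - c i)\<^sup>2"
        using power_mono[OF gap', of i 2] that K e(2) \<delta>0 by simp
      then show ?thesis
        using mult_right_mono[of _ _ "(a i)\<^sup>2"] by (simp add: coord[symmetric] power_mult_distrib)
    qed
    then have "(K * e + \<delta>)\<^sup>2 * (norm q)\<^sup>2 \<le> (\<Sum>i\<in>-S. (u i \<bullet> (E *v v))\<^sup>2)"
      by (auto simp: nq sum_distrib_left intro: sum_mono)
    then show ?thesis using Ebound[of v "-S"] v by simp
  qed
  \<comment> \<open>\<open>E *v v\<close> is split into \<open>E *v p\<close> and
    \<open>E *v q\<close>, at the cost of a factor 2 in the squares. Only \<open>p\<close> lies in
    the span of the \<open>u i\<close> with \<open>i \<in> S\<close>, so it gets the compression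
    bound, while \<open>q\<close> gets the norm bound \<open>e\<close>.\<close>
  have p1: "\<delta>\<^sup>2 * (norm p)\<^sup>2 \<le> 2 * (real (card S) * x * e) * (norm p)\<^sup>2 + 2 * e\<^sup>2 * (norm q)\<^sup>2"
  proof -
    have "\<delta>\<^sup>2 * (a i)\<^sup>2 \<le> 2 * (u i \<bullet> (E *v p))\<^sup>2 + 2 * (u i \<bullet> (E *v q))\<^sup>2" for i
    proof -
      have "\<delta>\<^sup>2 \<le> (\<mu> - c i)\<^sup>2"
        using power_mono[OF gap, of 2 i] \<delta>0 by simp
      then have "\<delta>\<^sup>2 * (a i)\<^sup>2 \<le> (u i \<bullet> (E *v v))\<^sup>2"
        using mult_right_mono[of _ _ "(a i)\<^sup>2"] by (simp add: coord[symmetric] power_mult_distrib)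
      also have "\<dots> = (u i \<bullet> (E *v p) + u i \<bullet> (E *v q))\<^sup>2"
        by (simp add: vpq matrix_vector_right_distrib inner_add_right)
      also have "\<dots> \<le> 2 * (u i \<bullet> (E *v p))\<^sup>2 + 2 * (u i \<bullet> (E *v q))\<^sup>2"
        using sum_squares_bound[of "u i \<bullet> (E *v p)" "u i \<bullet> (E *v q)"] by (simp add: power2_sum)
      finally show ?thesis .
    qed
    then have "\<delta>\<^sup>2 * (norm p)\<^sup>2 \<le> (\<Sum>i\<in>S. 2 * (u i \<bullet> (E *v p))\<^sup>2 + 2 * (u i \<bullet> (E *v q))\<^sup>2)"
      by (auto simp: np sum_distrib_left intro: sum_mono)
    also have "\<dots> = 2 * (\<Sum>i\<in>S. (u i \<bullet> (E *v p))\<^sup>2) + 2 * (\<Sum>i\<in>S. (u i \<bullet> (E *v q))\<^sup>2)"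
      by (simp add: sum.distrib sum_distrib_left)
    finally show ?thesis
      using compression_bound[OF on e(1) _ x p_def] Ebound[of q S] e(2) by simp
  qed
  have Ke: "K * \<delta> \<ge> 45 * e" using \<delta>(1) K by (simp add: field_simps)
  \<comment> \<open>The constant is 4 * 45: \<open>(K * e + \<delta>)\<^sup>2\<close> is at least
    \<open>4 * (K * e) * \<delta>\<close>, and \<open>K * \<delta>\<close> is at least
    \<open>45 * e\<close>.\<close>
  have q2: "180 * (norm q)\<^sup>2 \<le> 1"
  proof -
    have "180 * e\<^sup>2 \<le> 4 * (K * e) * \<delta>"
      using mult_right_mono[OF Ke, of e] e(2) by (simp add: power2_eq_square algebra_simps)
    also have "\<dots> \<le> (K * e + \<delta>)\<^sup>2"
      using sum_squares_bound[of "K * e" \<delta>] by (simp add: power2_sum algebra_simps)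
    finally have "(180 * e\<^sup>2) * (norm q)\<^sup>2 \<le> e\<^sup>2"
      using q1 mult_right_mono[of "180 * e\<^sup>2" _ "(norm q)\<^sup>2"] by fastforce
    then show ?thesis using e(2) by simp
  qed
  \<comment> \<open>For large \<open>K\<close> the norm \<open>e\<close> may exceed
    \<open>\<delta>\<close>, so smallness of \<open>q\<close> as in \<open>q2\<close> does not
    control the error term of \<open>p1\<close>. Keeping only \<open>K * e\<close> from the gap
    gives \<open>K * norm q \<le> 1\<close>, and \<open>K * \<delta> \<ge> 45 * e\<close> turns this
    into a bound by \<open>\<delta>\<close>; 2025 is 45^2.\<close>
  have q3: "2025 * (e\<^sup>2 * (norm q)\<^sup>2) \<le> \<delta>\<^sup>2"
  proof -
    have "K\<^sup>2 * (norm q)\<^sup>2 \<le> 1"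
    proof -
      have "(K * e)\<^sup>2 \<le> (K * e + \<delta>)\<^sup>2" using K e(2) \<delta>0 by (intro power_mono) auto
      then have "(K * e)\<^sup>2 * (norm q)\<^sup>2 \<le> e\<^sup>2"
        using q1 mult_right_mono[of "(K * e)\<^sup>2" _ "(norm q)\<^sup>2"] by fastforce
      then show ?thesis using e(2) by (simp add: power_mult_distrib)
    qed
    moreover have "2025 * e\<^sup>2 \<le> K\<^sup>2 * \<delta>\<^sup>2"
      using power_mono[OF Ke, of 2] e(2) by (simp add: power_mult_distrib)
    then have "2025 * e\<^sup>2 * (norm q)\<^sup>2 \<le> \<delta>\<^sup>2 * (K\<^sup>2 * (norm q)\<^sup>2)"
      using mult_right_mono[of "2025 * e\<^sup>2" "K\<^sup>2 * \<delta>\<^sup>2" "(norm q)\<^sup>2"] by (simp add: algebra_simps)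
    ultimately show ?thesis
      using mult_left_mono[of "K\<^sup>2 * (norm q)\<^sup>2" 1 "\<delta>\<^sup>2"] by simp
  qed
  have "x \<ge> 0" using x by (meson abs_ge_zero order_trans)
  then have "2025 * (real (card S) * x * e) \<le> \<delta>\<^sup>2"
    using power_mono[OF \<delta>(2), of 2] e(2) by (simp add: power_mult_distrib)
  then have "2025 * (real (card S) * x * e) * (norm p)\<^sup>2 \<le> \<delta>\<^sup>2 * (norm p)\<^sup>2"
    by (intro mult_right_mono) auto
  \<comment> \<open>\<open>p1\<close> multiplied by 2025 has at most \<open>2 * (\<delta>\<^sup>2 *
    (norm p)\<^sup>2) + 2 * \<delta>\<^sup>2\<close> on the right; absorbing the first term leaves
    2023 = 2025 - 2. The squared norms of \<open>p\<close> and \<open>q\<close> are then at most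
    2/2023 and 1/180, too small to add up to 1.\<close>
  with p1 q3 have "2023 * (\<delta>\<^sup>2 * (norm p)\<^sup>2) \<le> 2 * \<delta>\<^sup>2" by linarith
  then have "2023 * (norm p)\<^sup>2 \<le> 2" using \<delta>0 by simp
  with q2 pq show False by linarith
qed

section \<open>The smallest singular value of the perturbed matrix\<close>

theorem theorem3p4:
  fixes A E :: "real^'n^'n"
    and u :: "'n \<Rightarrow> real^'n"
    and K x :: real and r :: nat
  assumes "transpose A = A" and "transpose E = E" and "E \<noteq> 0"
    and "orthonormal_eigenbasis A u"
    and "x = Max {\<bar>u i \<bullet> (E *v u j)\<bar> | i j. True}"
    and "K > 0"
    and "r = size {#s \<in># singular_values A.
                     s \<le> singular_value A CARD('n) + K * spectral_norm E#}"
    and "singular_value A CARD('n) >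
           90 * ln (3 + singular_value A 1 / sqrt (real r * x * spectral_norm E)) *
           max (spectral_norm E / K) (sqrt (real r * x * spectral_norm E))"
  shows "singular_value (A + E) CARD('n) \<ge>
           singular_value A CARD('n) -
           45 * ln (3 + singular_value A 1 / sqrt (real r * x * spectral_norm E)) *
           max (spectral_norm E / K) (sqrt (real r * x * spectral_norm E))"
proof (rule ccontr)
  let ?e = "spectral_norm E" and ?\<sigma> = "singular_value A CARD('n)"
  define L where "L = ln (3 + singular_value A 1 / sqrt (real r * x * ?e))"
  define M where "M = max (?e / K) (sqrt (real r * x * ?e))"
  assume "\<not> ?thesis"
  then have less: "singular_value (A + E) CARD('n) < ?\<sigma> - 45 * L * M"
    by (simp add: L_def M_def)
  obtain c where on: "\<And>i j. u i \<bullet> u j = (if i = j then 1 else 0)" and eig: "\<And>i. A *v u i = c i *\<^sub>R u i"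
    using orthonormal_eigenbasisE[OF assms(4)] by metis
  note sv = singular_values_symmetric[OF assms(1) on eig]
  have size: "size (singular_values A) = CARD('n)" by (simp add: sv)
  have \<sigma>_le: "?\<sigma> \<le> \<bar>c i\<bar>" for i
    using singular_value_last(2)[OF size] by (auto simp: sv)
  have \<sigma>1: "singular_value A 1 \<ge> 0"
    using singular_value_last(3)[OF size] by (auto simp: sv)
  have e: "norm (E *v w) \<le> ?e * norm w" for w
    unfolding spectral_norm_def by (rule onorm) simp
  have e0: "?e > 0"
    using assms(3) onorm_pos_lt[of "(*v) E"] by (simp add: spectral_norm_def matrix_eq)
  have x: "\<bar>u i \<bullet> (E *v u j)\<bar> \<le> x" for i j
    unfolding assms(5)
  proof (rule Max_ge)
    have "{\<bar>u i \<bullet> (E *v u j)\<bar> | i j. True} = (\<lambda>(i, j). \<bar>u i \<bullet> (E *v u j)\<bar>) ` UNIV" by auto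
    then show "finite {\<bar>u i \<bullet> (E *v u j)\<bar> | i j. True}" by simp
  qed auto
  then have x0: "x \<ge> 0" by (meson abs_ge_zero order_trans)
  \<comment> \<open>The argument of the logarithm is at least 3, hence at least
    \<open>exp 1\<close>. This includes \<open>x = 0\<close>, where the quotient is 0 by the
    convention on division by zero.\<close>
  have L1: "L \<ge> 1"
  proof -
    have "exp 1 \<le> (3::real)" by (rule exp_le)
    also have "\<dots> \<le> 3 + singular_value A 1 / sqrt (real r * x * ?e)"
      using \<sigma>1 x0 e0 by simp
    finally show ?thesis unfolding L_def by (simp add: ln_ge_iff order_less_le_trans[OF exp_gt_zero])
  qed
  define S where "S = {i. \<bar>c i\<bar> \<le> ?\<sigma> + K * ?e}"
  have r: "r = card S"
    by (simp add: assms(7) sv S_def filter_mset_image_mset)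
  have M0: "M \<ge> 0" using assms(6) e0 by (simp add: M_def le_max_iff_disj)
  have LM: "M \<le> L * M" using mult_right_mono[OF L1 M0] by simp
  have sym: "transpose (A + E) = A + E"
    using assms(1,2) by (simp add: vec_eq_iff transpose_def)
  obtain v \<mu> where v: "norm v = 1" "(A + E) *v v = \<mu> *\<^sub>R v" and \<mu>: "\<bar>\<mu>\<bar> = singular_value (A + E) CARD('n)"
    using eigenvalue_singular_value_last[OF sym] by blast
  \<comment> \<open>Both gaps are lower bounds for
    \<open>\<bar>c i\<bar> - \<bar>\<mu>\<bar>\<close>, so the signs of the eigenvalues do not
    matter.\<close>
  have gap: "45 * L * M \<le> \<bar>\<mu> - c i\<bar>" for i
    using \<sigma>_le[of i] \<mu> less by linarith
  have gap': "K * ?e + 45 * L * M \<le> \<bar>\<mu> - c i\<bar>" if "i \<notin> S" for i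
    using that \<mu> less unfolding S_def by simp
  have \<delta>: "45 * L * M \<ge> 45 * (?e / K)" "45 * L * M \<ge> 45 * sqrt (real (card S) * x * ?e)"
    using LM by (auto simp: M_def r)
  show False
    using no_eigenvalue_in_gap[OF assms(1) on eig e e0 x assms(6) \<delta> gap gap' v(1)] v(2) by blast
qed

end
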